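(* Let $I,J,\tilde N\ge 1$ be integers, $N=IJ$, let $T\in\mathbb{C}^{\tilde N\times N}$ (the matrix of a wavelet transform), let $B_k\in\mathbb{C}^{N\times N}$ be Hermitian positive definite, $v_k\in\mathbb{C}^N$, $\bar\lambda>0$ and $\alpha\in[0,1]$. Let $(\mathrm{TV},\mathcal P)$ be either $(\mathrm{TV}_{\mathrm{iso}},\mathcal P_1)$ or $(\mathrm{TV}_{\ell_1},\mathcal P_2)$. For $z\in\mathbb{C}^{\tilde N}$, $P\in\mathbb{C}^{(I-1)\times J}$, $Q\in\mathbb{C}^{I\times(J-1)}$ put $$w_k(z,P,Q)=v_k-\bar\lambda B_k^{-1}\Big(\alpha T^{\mathcal H}z+(1-\alpha)\,\mathrm{vec}\big(\mathcal L(P,Q)\big)\Big).$$ Let $$(z^*,P^*,Q^* )\in\operatorname*{argmin}_{z\in\mathcal Z,\ (P,Q)\in\mathcal P}\ \big\|w_k(z,P,Q)\big\|_{B_k}^2 .$$ Then the optimal solution of $$\min_{x\in\mathbb{C}^N}\ \|x-v_k\|_{B_k}^2+2\bar\lambda\big[\alpha\|Tx\|_1+(1-\alpha)\mathrm{TV}(x)\big]$$ is given by $x_{k+1}=w_k(z^*,P^*,Q^* )$.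
   Context: Notation. $^{\mathcal H}$ denotes conjugate transpose; $\|q\|_{B}=\sqrt{q^{\mathcal H}Bq}$ for Hermitian positive definite $B$; $\|\cdot\|_1$ is the sum of the moduli of the entries. $\mathrm{vec}:\mathbb{C}^{I\times J}\to\mathbb{C}^{N}$ is column stacking, and $X=\mathrm{mat}(x)\in\mathbb{C}^{I\times J}$ is its inverse applied to $x\in\mathbb{C}^N$; $\mathrm{TV}(x)$ means $\mathrm{TV}(\mathrm{mat}(x))$. Total variation functions, for $X\in\mathbb{C}^{I\times J}$: $$\mathrm{TV}_{\mathrm{iso}}(X)=\sum_{i=1}^{I-1}\sum_{j=1}^{J-1}\sqrt{|X_{i,j}-X_{i+1,j}|^2+|X_{i,j}-X_{i,j+1}|^2}+\sum_{i=1}^{I-1}|X_{i,J}-X_{i+1,J}|+\sum_{j=1}^{J-1}|X_{I,j}-X_{I,j+1}|,$$ $$\mathrm{TV}_{\ell_1}(X)=\sum_{i=1}^{I-1}\sum_{j=1}^{J-1}\big\{|X_{i,j}-X_{i+1,j}|+|X_{i,j}-X_{i,j+1}|\big\}+\sum_{i=1}^{I-1}|X_{i,J}-X_{i+1,J}|+\sum_{j=1}^{J-1}|X_{I,j}-X_{I,j+1}|.$$ Linear operator $\mathcal L:\mathbb{C}^{(I-1)\times J}\times\mathbb{C}^{I\times(J-1)}\to\mathbb{C}^{I\times J}$: $\mathcal L(P,Q)_{i,j}=P_{i,j}+Q_{i,j}-P_{i-1,j}-Q_{i,j-1}$ for all $i,j$, with the convention $P_{0,j}=P_{I,j}=Q_{i,0}=Q_{i,J}=0$.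 Sets. $\mathcal Z=\{z\in\mathbb{C}^{\tilde N}: |z_n|\le 1\ \forall n\}$. $\mathcal P_1$ is the set of pairs $(P,Q)$ with $P\in\mathbb{C}^{(I-1)\times J}$, $Q\in\mathbb{C}^{I\times(J-1)}$ such that $|P_{i,j}|^2+|Q_{i,j}|^2\le1$ for $1\le i\le I-1$, $1\le j\le J-1$; $|P_{i,J}|\le1$ for $1\le i\le I-1$; and $|Q_{I,j}|\le 1$ for $1\le j\le J-1$. $\mathcal P_2$ is the set of such pairs with $|P_{i,j}|\le1$ and $|Q_{i,j}|\le 1$ for all $i,j$. In the paper $v_k$ is the vector $x_k-a_kB_k^{-1}\nabla f(x_k)$ arising at iteration $k$ of a quasi-Newton proximal method; in the statement it is simply a given vector of $\mathbb{C}^N$. *)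

theory Defs
  imports
    "Jordan_Normal_Form.Gauss_Jordan_Elimination"
    "Jordan_Normal_Form.Schur_Decomposition"
begin

text \<open>All indices are 0-based: an \<open>I \<times> J\<close> matrix has entries \<open>X $$ (i, j)\<close> with
  \<open>i < I\<close> and \<open>j < J\<close>, so the last row and column have indices \<open>I - 1\<close> and \<open>J - 1\<close>.
  Matrices with 0 rows or columns are allowed, as needed for \<open>P\<close> and \<open>Q\<close> when
  \<open>I = 1\<close> or \<open>J = 1\<close>.\<close>

definition hermitian_pos_def :: "nat \<Rightarrow> complex mat \<Rightarrow> bool" where
  "hermitian_pos_def n B \<longleftrightarrow> B \<in> carrier_mat n n \<and> mat_adjoint B = B \<and>
     (\<forall>q \<in> carrier_vec n. q \<noteq> 0\<^sub>v n \<longrightarrow> Re ((B *\<^sub>v q) \<bullet>c q) > 0)"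

text \<open>The product \<open>u \<bullet>c q\<close> is conjugate-linear in its second argument, so \<open>(B *\<^sub>v q) \<bullet>c q\<close>
  is \<open>q\<close> conjugate-transposed times \<open>B q\<close>. It is real for Hermitian \<open>B\<close>; \<open>Re\<close> only
  changes the type.\<close>

definition weighted_norm :: "complex mat \<Rightarrow> complex vec \<Rightarrow> real" where
  "weighted_norm B q = sqrt (Re ((B *\<^sub>v q) \<bullet>c q))"

definition l1_norm :: "complex vec \<Rightarrow> real" where
  "l1_norm q = (\<Sum>n<dim_vec q. cmod (q $ n))"

text \<open>Column stacking and its inverse.\<close>

definition vec_stack :: "complex mat \<Rightarrow> complex vec" where
  "vec_stack X = vec (dim_row X * dim_col X) (\<lambda>k. X $$ (k mod dim_row X, k div dim_row X))"

definition mat_unstack :: "nat \<Rightarrow> nat \<Rightarrow> complex vec \<Rightarrow> complex mat" where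
  "mat_unstack I J x = mat I J (\<lambda>(i, j). x $ (j * I + i))"

definition TV_iso :: "complex mat \<Rightarrow> real" where
  "TV_iso X = (let I = dim_row X; J = dim_col X in
     (\<Sum>i<I - 1. \<Sum>j<J - 1.
        sqrt ((cmod (X $$ (i, j) - X $$ (i + 1, j)))\<^sup>2 + (cmod (X $$ (i, j) - X $$ (i, j + 1)))\<^sup>2))
   + (\<Sum>i<I - 1. cmod (X $$ (i, J - 1) - X $$ (i + 1, J - 1)))
   + (\<Sum>j<J - 1. cmod (X $$ (I - 1, j) - X $$ (I - 1, j + 1))))"

definition TV_l1 :: "complex mat \<Rightarrow> real" where
  "TV_l1 X = (let I = dim_row X; J = dim_col X in
     (\<Sum>i<I - 1. \<Sum>j<J - 1.
        cmod (X $$ (i, j) - X $$ (i + 1, j)) + cmod (X $$ (i, j) - X $$ (i, j + 1)))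
   + (\<Sum>i<I - 1. cmod (X $$ (i, J - 1) - X $$ (i + 1, J - 1)))
   + (\<Sum>j<J - 1. cmod (X $$ (I - 1, j) - X $$ (I - 1, j + 1))))"

text \<open>The case distinctions implement the convention that \<open>P\<close> and \<open>Q\<close> are extended by 0
  outside their index ranges.\<close>

definition L_op :: "nat \<Rightarrow> nat \<Rightarrow> complex mat \<Rightarrow> complex mat \<Rightarrow> complex mat" where
  "L_op I J P Q = mat I J (\<lambda>(i, j).
       (if i < I - 1 then P $$ (i, j) else 0)
     + (if j < J - 1 then Q $$ (i, j) else 0)
     - (if 0 < i then P $$ (i - 1, j) else 0)
     - (if 0 < j then Q $$ (i, j - 1) else 0))"

definition Z_set :: "nat \<Rightarrow> complex vec set" where
  "Z_set m = {z \<in> carrier_vec m. \<forall>n<m. cmod (z $ n) \<le> 1}"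

definition P1_set :: "nat \<Rightarrow> nat \<Rightarrow> (complex mat \<times> complex mat) set" where
  "P1_set I J = {(P, Q). P \<in> carrier_mat (I - 1) J \<and> Q \<in> carrier_mat I (J - 1) \<and>
     (\<forall>i<I - 1. \<forall>j<J - 1. (cmod (P $$ (i, j)))\<^sup>2 + (cmod (Q $$ (i, j)))\<^sup>2 \<le> 1) \<and>
     (\<forall>i<I - 1. cmod (P $$ (i, J - 1)) \<le> 1) \<and>
     (\<forall>j<J - 1. cmod (Q $$ (I - 1, j)) \<le> 1)}"

definition P2_set :: "nat \<Rightarrow> nat \<Rightarrow> (complex mat \<times> complex mat) set" where
  "P2_set I J = {(P, Q). P \<in> carrier_mat (I - 1) J \<and> Q \<in> carrier_mat I (J - 1) \<and>
     (\<forall>i<I - 1. \<forall>j<J. cmod (P $$ (i, j)) \<le> 1) \<and>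
     (\<forall>i<I. \<forall>j<J - 1. cmod (Q $$ (i, j)) \<le> 1)}"

text \<open>\<^const>\<open>mat_inverse\<close> is option-valued; the result is \<open>Some\<close> of the inverse whenever
  \<open>B\<close> is invertible, in particular for positive definite \<open>B\<close>.\<close>

definition w_map ::
  "nat \<Rightarrow> nat \<Rightarrow> complex mat \<Rightarrow> complex mat \<Rightarrow> complex vec \<Rightarrow> real \<Rightarrow> real \<Rightarrow>
   complex vec \<Rightarrow> complex mat \<Rightarrow> complex mat \<Rightarrow> complex vec" where
  "w_map I J T B v lam \<alpha> z P Q =
     v - complex_of_real lam \<cdot>\<^sub>v (the (mat_inverse B) *\<^sub>v
       (complex_of_real \<alpha> \<cdot>\<^sub>v (mat_adjoint T *\<^sub>v z)
        + complex_of_real (1 - \<alpha>) \<cdot>\<^sub>v vec_stack (L_op I J P Q)))"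

end

theory Submission
  imports Defs "HOL-Analysis.Convex"
begin

text \<open>
  Write \<open>\<langle>x, y\<rangle>\<close> for the real part of the Hermitian product. Each of the two penalties is a
  support function: \<open>\<parallel>T x\<parallel>\<^sub>1\<close> is the maximum of \<open>\<langle>x, T\<^sup>H z\<rangle>\<close> over \<open>z\<close> in the polydisc, and
  \<open>TV(x)\<close> is the maximum of \<open>\<langle>x, vec (L(P, Q))\<rangle>\<close> over the dual set, because \<open>L\<close> is the adjoint of
  the discrete gradient (summation by parts). Hence the whole penalty is
  \<open>h(x) = max {\<langle>x, g\<rangle> | g \<in> G}\<close> for the convex set \<open>G\<close> of all vectors
  \<open>\<alpha> T\<^sup>H z + (1 - \<alpha>) vec (L(P, Q))\<close>, and the candidate solution is
  \<open>w = v - \<lambda> B\<^sup>-\<^sup>1 g\<^sub>*\<close>, where \<open>g\<^sub>* \<in> G\<close> minimises \<open>\<parallel>v - \<lambda> B\<^sup>-\<^sup>1 g\<parallel>\<^sub>B\<close>.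

  Moving from \<open>g\<^sub>*\<close> towards another \<open>g \<in> G\<close> does not decrease the
  dual objective, and the first-order part of this statement is \<open>\<langle>w, g\<rangle> \<le> \<langle>w, g\<^sub>*\<rangle>\<close>: the factor \<open>B\<close>
  of the norm cancels the inverse in \<open>w\<close>. So \<open>g\<^sub>*\<close> attains the maximum that defines \<open>h(w)\<close>.
  For every \<open>x\<close>, completing the square around \<open>w\<close> then gives
  \<open>\<parallel>x - v\<parallel>\<^sub>B\<^sup>2 + 2\<lambda> h(x) \<ge> \<parallel>x - v\<parallel>\<^sub>B\<^sup>2 + 2\<lambda> \<langle>x, g\<^sub>*\<rangle> = \<parallel>x - w\<parallel>\<^sub>B\<^sup>2 + \<parallel>w - v\<parallel>\<^sub>B\<^sup>2 + 2\<lambda> h(w)\<close>,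
  which makes \<open>w\<close> the only minimiser. This argument is
  \<open>dual_minimiser_gives_primal_minimiser\<close>.

  That \<open>G\<close> is convex with attained support function \<open>h\<close> is assembled from
  \<open>is_support_l1_norm\<close>, \<open>is_support_mat_adjoint\<close>,
  \<open>is_support_nonneg_combination\<close> and \<open>is_support_cell_TV\<close>. The last one treats both total
  variations at once: they differ only in the norm \<open>\<nu>\<close> that measures the gradient in an interior
  cell, and the dual sets only in the corresponding dual unit ball \<open>U\<close>.
\<close>

section \<open>The real inner product and the weighted norm\<close>

definition re_inner :: "complex vec \<Rightarrow> complex vec \<Rightarrow> real" where
  "re_inner x y = Re (x \<bullet>c y)"

lemma re_inner_eq_sum:
  assumes "y \<in> carrier_vec n"
  shows "re_inner x y = (\<Sum>i<n. inner (x $ i) (y $ i))"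
  using assms
  by (auto simp: re_inner_def scalar_prod_def inner_complex_def lessThan_atLeast0 intro!: sum.cong)

lemma re_inner_commute:
  assumes "x \<in> carrier_vec n" "y \<in> carrier_vec n"
  shows "re_inner x y = re_inner y x"
  using assms by (simp add: re_inner_eq_sum inner_commute)

lemma inner_of_real_mult_right: "inner (a :: complex) (complex_of_real r * b) = r * inner a b"
  by (simp add: inner_complex_def algebra_simps)

lemma re_inner_add_right:
  assumes "y \<in> carrier_vec n" "z \<in> carrier_vec n"
  shows "re_inner x (y + z) = re_inner x y + re_inner x z"
  using assms by (simp add: re_inner_eq_sum[of _ n] inner_add_right sum.distrib)

lemma re_inner_diff_right:
  assumes "y \<in> carrier_vec n" "z \<in> carrier_vec n"
  shows "re_inner x (y - z) = re_inner x y - re_inner x z"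
  using assms by (simp add: re_inner_eq_sum[of _ n] inner_diff_right sum_subtractf)

lemma re_inner_smult_right:
  assumes "y \<in> carrier_vec n"
  shows "re_inner x (complex_of_real r \<cdot>\<^sub>v y) = r * re_inner x y"
  using assms by (simp add: re_inner_eq_sum[of _ n] inner_of_real_mult_right sum_distrib_left)

lemma mat_adjoint_carrier [simp]:
  "A \<in> carrier_mat m n \<Longrightarrow> mat_adjoint A \<in> carrier_mat n m"
  by (rule carrier_matI) (auto simp: mat_adjoint_def)

lemma re_inner_mult_mat_vec:
  assumes "A \<in> carrier_mat m n" "x \<in> carrier_vec n" "y \<in> carrier_vec m"
  shows "re_inner (A *\<^sub>v x) y = re_inner x (mat_adjoint A *\<^sub>v y)"
proof -
  have "(A *\<^sub>v x) \<bullet>c y = (\<Sum>i<m. \<Sum>j<n. A $$ (i, j) * x $ j * cnj (y $ i))"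
    using assms by (auto simp: scalar_prod_def lessThan_atLeast0 sum_distrib_right intro!: sum.cong)
  also have "\<dots> = (\<Sum>j<n. \<Sum>i<m. A $$ (i, j) * x $ j * cnj (y $ i))"
    by (rule sum.swap)
  also have "\<dots> = x \<bullet>c (mat_adjoint A *\<^sub>v y)"
    using assms
    by (auto simp: scalar_prod_def lessThan_atLeast0 sum_distrib_left mat_adjoint_def
        mat_of_rows_def mult.assoc mult.left_commute intro!: sum.cong)
  finally show ?thesis by (simp add: re_inner_def)
qed

lemma weighted_norm_sq:
  assumes "hermitian_pos_def n B" "q \<in> carrier_vec n"
  shows "(weighted_norm B q)\<^sup>2 = re_inner q (B *\<^sub>v q)"
    and "q \<noteq> 0\<^sub>v n \<Longrightarrow> 0 < (weighted_norm B q)\<^sup>2"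
proof -
  have Bq: "B *\<^sub>v q \<in> carrier_vec n"
    using assms by (auto simp: hermitian_pos_def_def)
  have nonneg: "0 \<le> re_inner (B *\<^sub>v q) q"
  proof (cases "q = 0\<^sub>v n")
    case True
    then show ?thesis by (simp add: re_inner_eq_sum[of _ n])
  next
    case False
    then show ?thesis using assms by (auto simp: hermitian_pos_def_def re_inner_def less_imp_le)
  qed
  then show "(weighted_norm B q)\<^sup>2 = re_inner q (B *\<^sub>v q)"
    using re_inner_commute[OF assms(2) Bq] by (simp add: weighted_norm_def re_inner_def)
  then show "0 < (weighted_norm B q)\<^sup>2" if "q \<noteq> 0\<^sub>v n"
    using re_inner_commute[OF assms(2) Bq] assms that
    by (auto simp: hermitian_pos_def_def re_inner_def)
qed

lemma weighted_norm_sq_add_smult: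
  assumes B: "hermitian_pos_def n B" and p: "p \<in> carrier_vec n" and q: "q \<in> carrier_vec n"
  shows "(weighted_norm B (p + complex_of_real s \<cdot>\<^sub>v q))\<^sup>2
    = (weighted_norm B p)\<^sup>2 + 2 * s * re_inner p (B *\<^sub>v q) + s\<^sup>2 * (weighted_norm B q)\<^sup>2"
proof -
  have Bc: "B \<in> carrier_mat n n" and adj: "mat_adjoint B = B"
    using B by (auto simp: hermitian_pos_def_def)
  let ?u = "p + complex_of_real s \<cdot>\<^sub>v q"
  have Bp: "B *\<^sub>v p \<in> carrier_vec n" and Bq: "B *\<^sub>v q \<in> carrier_vec n"
    using Bc p q by auto
  have u: "?u \<in> carrier_vec n" using p q by auto
  have Bu: "B *\<^sub>v ?u = B *\<^sub>v p + complex_of_real s \<cdot>\<^sub>v (B *\<^sub>v q)"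
    using Bc p q by (simp add: mult_add_distrib_mat_vec mult_mat_vec)
  have left: "re_inner ?u y = re_inner p y + s * re_inner q y" if y: "y \<in> carrier_vec n" for y
  proof -
    have "re_inner ?u y = re_inner y ?u" by (rule re_inner_commute[OF u y])
    also have "\<dots> = re_inner y p + s * re_inner y q"
      using p q by (simp add: re_inner_add_right[of _ n] re_inner_smult_right[of _ n])
    finally show ?thesis
      using re_inner_commute[OF p y] re_inner_commute[OF q y] by simp
  qed
  have sym: "re_inner q (B *\<^sub>v p) = re_inner p (B *\<^sub>v q)"
    using re_inner_mult_mat_vec[OF Bc q p] re_inner_commute[OF Bq p] adj by simp
  show ?thesis
    unfolding weighted_norm_sq(1)[OF B u] weighted_norm_sq(1)[OF B p] weighted_norm_sq(1)[OF B q] Bu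
    using Bp Bq
    by (simp add: left re_inner_add_right[of _ n] re_inner_smult_right[of _ n] sym
        power2_eq_square algebra_simps)
qed

text \<open>A kernel vector \<open>q \<noteq> 0\<close> of \<open>B\<close> would make the quadratic form vanish at \<open>q\<close>.\<close>

lemma hermitian_pos_def_inverse:
  assumes "hermitian_pos_def n B"
  shows "the (mat_inverse B) \<in> carrier_mat n n" and "B * the (mat_inverse B) = 1\<^sub>m n"
proof -
  have Bc: "B \<in> carrier_mat n n"
    using assms by (auto simp: hermitian_pos_def_def)
  have "det B \<noteq> 0"
  proof
    assume "det B = 0"
    then obtain q where q: "q \<in> carrier_vec n" "q \<noteq> 0\<^sub>v n" "B *\<^sub>v q = 0\<^sub>v n"
      using det_0_iff_vec_prod_zero[OF Bc] by auto
    then have "Re (0\<^sub>v n \<bullet>c q) > 0"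
      using assms by (fastforce simp: hermitian_pos_def_def)
    then show False using q by simp
  qed
  then obtain C where "mat_inverse B = Some C"
    using det_non_zero_imp_unit[OF Bc] mat_inverse(1)[OF Bc] by (metis option.exhaust)
  with mat_inverse(2)[OF Bc this]
  show "the (mat_inverse B) \<in> carrier_mat n n" "B * the (mat_inverse B) = 1\<^sub>m n" by auto
qed

section \<open>Duality for attained support functions\<close>

definition mix :: "real \<Rightarrow> complex vec \<Rightarrow> complex vec \<Rightarrow> complex vec" where
  "mix t g h = complex_of_real (1 - t) \<cdot>\<^sub>v g + complex_of_real t \<cdot>\<^sub>v h"

text \<open>The value \<open>h x\<close> is required to be attained, since the proof of optimality bounds \<open>h\<close> at
  the candidate by the pairing with a maximising element.\<close>

definition is_support :: "nat \<Rightarrow> complex vec set \<Rightarrow> (complex vec \<Rightarrow> real) \<Rightarrow> bool" where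
  "is_support n G h \<longleftrightarrow> G \<subseteq> carrier_vec n \<and>
     (\<forall>g\<in>G. \<forall>g'\<in>G. \<forall>t\<in>{0..1}. mix t g g' \<in> G) \<and>
     (\<forall>x\<in>carrier_vec n. (\<forall>g\<in>G. re_inner x g \<le> h x) \<and> (\<exists>g\<in>G. re_inner x g = h x))"

text \<open>Divide by \<open>t\<close> and let \<open>t\<close> tend to 0: this extracts the first-order condition along a segment
  that starts at a minimiser.\<close>

lemma nonpos_if_quadratic_dominates:
  fixes a c :: real
  assumes "\<And>t. 0 < t \<Longrightarrow> t \<le> 1 \<Longrightarrow> t * a \<le> t\<^sup>2 * c" and "0 \<le> c"
  shows "a \<le> 0"
proof (rule ccontr)
  assume "\<not> a \<le> 0"
  then have a: "0 < a" by simp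
  \<comment> \<open>Small enough for \<open>t * c < a\<close>; the summand 1 covers \<open>c = 0\<close>.\<close>
  define t where "t = min 1 (a / (c + 1))"
  have t: "0 < t" "t \<le> 1" using a assms(2) by (auto simp: t_def)
  have "t * (c + 1) \<le> a" using assms(2) by (simp add: t_def min_mult_distrib_right)
  moreover have "a \<le> t * c"
    using assms(1)[OF t] t by (simp add: power2_eq_square)
  ultimately show False using t by (simp add: algebra_simps)
qed

text \<open>The first-order condition at the dual minimiser says that \<open>gs\<close> attains \<open>h (w gs)\<close>; completing
  the square then leaves the surplus \<open>(weighted_norm B (x - w gs))\<^sup>2\<close> for every competitor \<open>x\<close>,
  and this surplus gives both minimality and uniqueness.\<close>

theorem dual_minimiser_gives_primal_minimiser:
  assumes B: "hermitian_pos_def n B" and v: "v \<in> carrier_vec n" and lam: "lam > 0"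
    and G: "is_support n G h"
    and gs: "gs \<in> G"
    and w: "\<And>g. w g = v - complex_of_real lam \<cdot>\<^sub>v (the (mat_inverse B) *\<^sub>v g)"
    and min: "\<And>g. g \<in> G \<Longrightarrow> (weighted_norm B (w gs))\<^sup>2 \<le> (weighted_norm B (w g))\<^sup>2"
  shows "{x. is_arg_min (\<lambda>x. (weighted_norm B (x - v))\<^sup>2 + 2 * lam * h x)
               (\<lambda>x. x \<in> carrier_vec n) x} = {w gs}"
proof -
  define C where "C = the (mat_inverse B)"
  have C: "C \<in> carrier_mat n n" and BC: "B * C = 1\<^sub>m n"
    using hermitian_pos_def_inverse[OF B] by (auto simp: C_def)
  have Bc: "B \<in> carrier_mat n n" using B by (auto simp: hermitian_pos_def_def)
  have Gc: "g \<in> carrier_vec n" if "g \<in> G" for g using G that by (auto simp: is_support_def)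
  have gsc: "gs \<in> carrier_vec n" using Gc gs .
  have BCg: "B *\<^sub>v (C *\<^sub>v g) = g" if "g \<in> carrier_vec n" for g
    using assoc_mult_mat_vec[OF Bc C that] BC that by simp
  have Cg: "C *\<^sub>v g \<in> carrier_vec n" if "g \<in> carrier_vec n" for g using C that by auto
  have wc: "w g \<in> carrier_vec n" if "g \<in> carrier_vec n" for g
    using v Cg[OF that] by (simp add: w C_def)
  note ws = wc[OF gsc]
  \<comment> \<open>Along the segment from \<open>gs\<close> to \<open>g\<close> the argument of the norm moves by
    \<open>- lam * t\<close> times \<open>q\<close>, and \<open>B\<close> maps \<open>q\<close> back to \<open>g - gs\<close>.\<close>
  have optimality: "re_inner (w gs) g \<le> re_inner (w gs) gs" if g: "g \<in> G" for g
  proof -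
    have gc: "g \<in> carrier_vec n" using Gc g .
    define q where "q = C *\<^sub>v (g - gs)"
    have q: "q \<in> carrier_vec n" using Cg gc gsc by (simp add: q_def)
    have "t * (2 * lam * re_inner (w gs) (g - gs)) \<le> t\<^sup>2 * (lam\<^sup>2 * (weighted_norm B q)\<^sup>2)"
      if t: "0 < t" "t \<le> 1" for t
    proof -
      have Cmix: "C *\<^sub>v mix t gs g = C *\<^sub>v gs + complex_of_real t \<cdot>\<^sub>v (C *\<^sub>v g - C *\<^sub>v gs)"
        using gc gsc C Cg[OF gc] Cg[OF gsc]
        by (intro eq_vecI)
          (auto simp: mix_def mult_add_distrib_mat_vec[of _ n n] mult_mat_vec[of _ n n] algebra_simps)
      have wmix: "w (mix t gs g) = w gs + complex_of_real (- lam * t) \<cdot>\<^sub>v q"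
        using gc gsc C Cg[OF gc] Cg[OF gsc] v
        unfolding w C_def[symmetric] Cmix q_def mult_minus_distrib_mat_vec[OF C gc gsc]
        by (intro eq_vecI) (auto simp: algebra_simps)
      have "mix t gs g \<in> G" using G g gs t by (auto simp: is_support_def)
      from min[OF this] have "0 \<le> 2 * (- lam * t) * re_inner (w gs) (B *\<^sub>v q)
          + (- lam * t)\<^sup>2 * (weighted_norm B q)\<^sup>2"
        unfolding wmix weighted_norm_sq_add_smult[OF B ws q] by simp
      moreover have "B *\<^sub>v q = g - gs" using BCg gc gsc by (simp add: q_def)
      ultimately show ?thesis by (simp add: power_mult_distrib algebra_simps)
    qed
    from nonpos_if_quadratic_dominates[OF this]
    have "2 * lam * re_inner (w gs) (g - gs) \<le> 0" by simp
    then have "re_inner (w gs) (g - gs) \<le> 0" using lam by (simp add: mult_le_0_iff)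
    then show ?thesis using gc gsc by (simp add: re_inner_diff_right[of _ n])
  qed
  have h_ws: "h (w gs) = re_inner (w gs) gs"
  proof (rule antisym)
    obtain g where "g \<in> G" "re_inner (w gs) g = h (w gs)"
      using G ws unfolding is_support_def by blast
    then show "h (w gs) \<le> re_inner (w gs) gs" using optimality by metis
    show "re_inner (w gs) gs \<le> h (w gs)"
      using G gs ws unfolding is_support_def by blast
  qed
  have h_ge: "re_inner x gs \<le> h x" if "x \<in> carrier_vec n" for x
    using G gs that by (auto simp: is_support_def)
  let ?F = "\<lambda>x. (weighted_norm B (x - v))\<^sup>2 + 2 * lam * h x"
  have growth: "?F (w gs) + (weighted_norm B (x - w gs))\<^sup>2 \<le> ?F x" if x: "x \<in> carrier_vec n" for x
  proof -
    define d where "d = x - w gs"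
    have d: "d \<in> carrier_vec n" using x ws by (simp add: d_def)
    define y where "y = C *\<^sub>v gs"
    have y: "y \<in> carrier_vec n" using Cg[OF gsc] by (simp add: y_def)
    have By: "B *\<^sub>v y = gs" using BCg[OF gsc] by (simp add: y_def)
    have dims: "dim_vec x = n" "dim_vec v = n" "dim_vec y = n" "dim_vec (w gs) = n"
      using x v y ws by (simp_all only: carrier_vecD)
    have w_gs: "w gs = v - complex_of_real lam \<cdot>\<^sub>v y"
      by (simp add: w y_def C_def)
    \<comment> \<open>The zero summand puts \<open>w gs - v\<close> in the shape of the expansion of the squared norm.\<close>
    have wv: "w gs - v = 0\<^sub>v n + complex_of_real (- lam) \<cdot>\<^sub>v y"
      unfolding w_gs by (rule eq_vecI) (simp_all add: dims)
    have xv: "x - v = d + complex_of_real (- lam) \<cdot>\<^sub>v y"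
      unfolding w_gs d_def by (rule eq_vecI) (simp_all add: dims)
    have zero_left: "re_inner (0\<^sub>v n) u = 0" if "u \<in> carrier_vec n" for u
      using that by (simp add: re_inner_eq_sum)
    have "B *\<^sub>v 0\<^sub>v n \<in> carrier_vec n" using Bc by simp
    then have "(weighted_norm B (0\<^sub>v n))\<^sup>2 = 0"
      using zero_left weighted_norm_sq(1)[OF B zero_carrier_vec] by simp
    then have "(weighted_norm B (w gs - v))\<^sup>2 = lam\<^sup>2 * (weighted_norm B y)\<^sup>2"
      unfolding wv weighted_norm_sq_add_smult[OF B zero_carrier_vec y] By
      by (simp add: zero_left[OF gsc])
    moreover have "(weighted_norm B (x - v))\<^sup>2 = (weighted_norm B d)\<^sup>2 - 2 * lam * re_inner d gs
        + lam\<^sup>2 * (weighted_norm B y)\<^sup>2"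
      unfolding xv weighted_norm_sq_add_smult[OF B d y] By by simp
    moreover have "re_inner d gs = re_inner x gs - re_inner (w gs) gs"
      using re_inner_diff_right[OF x ws, of gs] re_inner_commute[OF gsc x]
        re_inner_commute[OF gsc ws] re_inner_commute[OF gsc d]
      by (simp add: d_def)
    moreover have "lam * re_inner x gs \<le> lam * h x"
      using h_ge[OF x] lam by simp
    ultimately show ?thesis unfolding d_def[symmetric] h_ws by (simp add: algebra_simps)
  qed
  have strict: "?F (w gs) < ?F x" if x: "x \<in> carrier_vec n" and ne: "x \<noteq> w gs" for x
  proof -
    have "x - w gs \<noteq> 0\<^sub>v n"
    proof
      assume z: "x - w gs = 0\<^sub>v n"
      have "x = w gs"
      proof (intro eq_vecI)
        fix i assume i: "i < dim_vec (w gs)"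
        then have "(x - w gs) $ i = 0" using z ws by simp
        then show "x $ i = w gs $ i" using i by simp
      qed (use x ws in auto)
      with ne show False by simp
    qed
    then have "0 < (weighted_norm B (x - w gs))\<^sup>2"
      using weighted_norm_sq(2)[OF B] x ws by simp
    then show ?thesis using growth[OF x] by linarith
  qed
  have "is_arg_min ?F (\<lambda>x. x \<in> carrier_vec n) x \<longleftrightarrow> x = w gs" for x
    unfolding is_arg_min_def
  proof
    assume "x \<in> carrier_vec n \<and> \<not> (\<exists>y. y \<in> carrier_vec n \<and> ?F y < ?F x)"
    then show "x = w gs" using strict ws by blast
  next
    assume "x = w gs"
    moreover have "\<not> ?F y < ?F (w gs)" if "y \<in> carrier_vec n" for y
      using strict[OF that] by (cases "y = w gs") (simp, linarith)
    ultimately show "x \<in> carrier_vec n \<and> \<not> (\<exists>y. y \<in> carrier_vec n \<and> ?F y < ?F x)"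
      using ws by blast
  qed
  then show ?thesis by blast
qed


section \<open>Support functions of the polydisc, of adjoint images and of sums\<close>

lemma inner_le_norm:
  fixes a u :: "'a :: real_inner"
  assumes "norm u \<le> 1"
  shows "inner a u \<le> norm a"
  using norm_cauchy_schwarz[of a u] mult_left_mono[OF assms norm_ge_zero[of a]] by simp

lemma inner_sgn_right: "inner a (sgn a) = norm (a :: 'a :: real_inner)"
  by (cases "a = 0") (simp_all add: sgn_div_norm dot_square_norm power2_eq_square)

lemma norm_convex_combination_le_1:
  fixes a b :: "'a :: real_normed_vector"
  assumes "norm a \<le> 1" "norm b \<le> 1" "0 \<le> s" "0 \<le> t" "s + t = 1"
  shows "norm (s *\<^sub>R a + t *\<^sub>R b) \<le> 1"
proof -
  have "norm (s *\<^sub>R a + t *\<^sub>R b) \<le> s * norm a + t * norm b"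
    using norm_triangle_ineq[of "s *\<^sub>R a" "t *\<^sub>R b"] assms by simp
  also have "\<dots> \<le> s * 1 + t * 1"
    using assms by (intro add_mono mult_left_mono) auto
  finally show ?thesis using assms by simp
qed

lemma norm_mix_le_1:
  assumes "cmod a \<le> 1" "cmod b \<le> 1" "t \<in> {0..1}"
  shows "cmod (complex_of_real (1 - t) * a + complex_of_real t * b) \<le> 1"
  using norm_convex_combination_le_1[of a b "1 - t" t] assms by (simp add: scaleR_conv_of_real)

lemma mix_index:
  assumes "g \<in> carrier_vec n" "g' \<in> carrier_vec n" "i < n"
  shows "mix t g g' $ i = complex_of_real (1 - t) * g $ i + complex_of_real t * g' $ i"
  using assms by (simp add: mix_def)

lemma mix_carrier [simp]:
  "g \<in> carrier_vec n \<Longrightarrow> g' \<in> carrier_vec n \<Longrightarrow> mix t g g' \<in> carrier_vec n"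
  by (simp add: mix_def)

lemma mult_mat_vec_mix:
  assumes "A \<in> carrier_mat m n" "g \<in> carrier_vec n" "g' \<in> carrier_vec n"
  shows "A *\<^sub>v mix t g g' = mix t (A *\<^sub>v g) (A *\<^sub>v g')"
  using assms by (simp add: mix_def mult_add_distrib_mat_vec[of _ m n] mult_mat_vec[of _ m n])

text \<open>The maximum is taken entrywise: \<open>sgn c\<close> is the unit number aligned with \<open>c\<close>. Where an entry of
  \<open>x\<close> vanishes, \<open>sgn 0 = 0\<close> is a valid choice too.\<close>

lemma is_support_l1_norm: "is_support m (Z_set m) l1_norm"
  unfolding is_support_def
proof (intro conjI ballI)
  show "Z_set m \<subseteq> carrier_vec m" by (auto simp: Z_set_def)
  show "mix t g g' \<in> Z_set m" if "g \<in> Z_set m" "g' \<in> Z_set m" "t \<in> {0..1}" for g g' t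
    using that norm_mix_le_1 by (auto simp: Z_set_def mix_index)
  fix x :: "complex vec" assume x: "x \<in> carrier_vec m"
  show "re_inner x g \<le> l1_norm x" if "g \<in> Z_set m" for g
    using that x by (auto simp: Z_set_def re_inner_eq_sum l1_norm_def intro!: sum_mono inner_le_norm)
  define z where "z = vec m (\<lambda>i. sgn (x $ i))"
  have "z \<in> Z_set m" by (auto simp: z_def Z_set_def norm_sgn)
  moreover have "re_inner x z = l1_norm x"
    using x by (auto simp: re_inner_eq_sum[of _ m] z_def l1_norm_def inner_sgn_right intro!: sum.cong)
  ultimately show "\<exists>g\<in>Z_set m. re_inner x g = l1_norm x" by blast
qed

lemma is_support_mat_adjoint:
  assumes A: "A \<in> carrier_mat m n" and G: "is_support m G h"
  shows "is_support n ((\<lambda>g. mat_adjoint A *\<^sub>v g) ` G) (\<lambda>x. h (A *\<^sub>v x))"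
proof -
  have Ga: "g \<in> carrier_vec m" if "g \<in> G" for g using G that by (auto simp: is_support_def)
  have A': "mat_adjoint A \<in> carrier_mat n m" using A by simp
  show ?thesis
    unfolding is_support_def
  proof (intro conjI ballI)
    show "(\<lambda>g. mat_adjoint A *\<^sub>v g) ` G \<subseteq> carrier_vec n" using A' Ga by auto
  next
    fix u u' t
    assume "u \<in> (\<lambda>g. mat_adjoint A *\<^sub>v g) ` G" "u' \<in> (\<lambda>g. mat_adjoint A *\<^sub>v g) ` G"
      and t: "t \<in> {0..(1::real)}"
    then obtain g g' where g: "g \<in> G" "g' \<in> G"
      and u: "u = mat_adjoint A *\<^sub>v g" "u' = mat_adjoint A *\<^sub>v g'" by blast
    have "mix t u u' = mat_adjoint A *\<^sub>v mix t g g'"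
      unfolding u using mult_mat_vec_mix[OF A' Ga Ga] g by simp
    moreover have "mix t g g' \<in> G" using G g t by (simp add: is_support_def)
    ultimately show "mix t u u' \<in> (\<lambda>g. mat_adjoint A *\<^sub>v g) ` G" by blast
  next
    fix x u :: "complex vec"
    assume x: "x \<in> carrier_vec n" and "u \<in> (\<lambda>g. mat_adjoint A *\<^sub>v g) ` G"
    then obtain g where g: "g \<in> G" and u: "u = mat_adjoint A *\<^sub>v g" by blast
    have "A *\<^sub>v x \<in> carrier_vec m" using A x by simp
    then have "re_inner (A *\<^sub>v x) g \<le> h (A *\<^sub>v x)" using G g unfolding is_support_def by blast
    then show "re_inner x u \<le> h (A *\<^sub>v x)"
      using re_inner_mult_mat_vec[OF A x Ga[OF g]] by (simp add: u)
  next
    fix x :: "complex vec" assume x: "x \<in> carrier_vec n"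
    then have "A *\<^sub>v x \<in> carrier_vec m" using A by simp
    then obtain g where "g \<in> G" "re_inner (A *\<^sub>v x) g = h (A *\<^sub>v x)"
      using G unfolding is_support_def by blast
    then show "\<exists>u\<in>(\<lambda>g. mat_adjoint A *\<^sub>v g) ` G. re_inner x u = h (A *\<^sub>v x)"
      using re_inner_mult_mat_vec[OF A x Ga] by auto
  qed
qed

lemma is_support_nonneg_combination:
  assumes G: "is_support n G h" and H: "is_support n H k" and a: "0 \<le> a" and b: "0 \<le> b"
  shows "is_support n
    ((\<lambda>(g, g'). complex_of_real a \<cdot>\<^sub>v g + complex_of_real b \<cdot>\<^sub>v g') ` (G \<times> H))
    (\<lambda>x. a * h x + b * k x)"
proof -
  let ?c = "\<lambda>g g'. complex_of_real a \<cdot>\<^sub>v g + complex_of_real b \<cdot>\<^sub>v g'"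
  have Gc: "g \<in> carrier_vec n" if "g \<in> G" for g using G that by (auto simp: is_support_def)
  have Hc: "g \<in> carrier_vec n" if "g \<in> H" for g using H that by (auto simp: is_support_def)
  have pairing: "re_inner x (?c g g') = a * re_inner x g + b * re_inner x g'"
    if "g \<in> G" "g' \<in> H" for x g g'
    using Gc Hc that by (simp add: re_inner_add_right[of _ n] re_inner_smult_right[of _ n])
  show ?thesis
    unfolding is_support_def
  proof (intro conjI ballI)
    show "(\<lambda>(g, g'). ?c g g') ` (G \<times> H) \<subseteq> carrier_vec n" using Gc Hc by auto
  next
    fix u u' t
    assume "u \<in> (\<lambda>(g, g'). ?c g g') ` (G \<times> H)" "u' \<in> (\<lambda>(g, g'). ?c g g') ` (G \<times> H)"
      and t: "t \<in> {0..(1::real)}"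
    then obtain g g' k k' where g: "g \<in> G" "g' \<in> G" and k: "k \<in> H" "k' \<in> H"
      and u: "u = ?c g k" "u' = ?c g' k'" by auto
    note dims = carrier_vecD[OF Gc[OF g(1)]] carrier_vecD[OF Gc[OF g(2)]]
      carrier_vecD[OF Hc[OF k(1)]] carrier_vecD[OF Hc[OF k(2)]]
    have "mix t u u' = ?c (mix t g g') (mix t k k')"
      unfolding u mix_def by (rule eq_vecI) (simp_all add: dims algebra_simps)
    moreover have "mix t g g' \<in> G" "mix t k k' \<in> H"
      using G H g k t by (simp_all add: is_support_def)
    ultimately show "mix t u u' \<in> (\<lambda>(g, g'). ?c g g') ` (G \<times> H)" by auto
  next
    fix x u :: "complex vec"
    assume x: "x \<in> carrier_vec n" and "u \<in> (\<lambda>(g, g'). ?c g g') ` (G \<times> H)"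
    then obtain g g' where g: "g \<in> G" "g' \<in> H" and u: "u = ?c g g'" by auto
    have "re_inner x g \<le> h x" "re_inner x g' \<le> k x"
      using G H g x unfolding is_support_def by blast+
    then show "re_inner x u \<le> a * h x + b * k x"
      unfolding u pairing[OF g] using a b by (intro add_mono mult_left_mono)
  next
    fix x :: "complex vec" assume x: "x \<in> carrier_vec n"
    obtain g where g: "g \<in> G" "re_inner x g = h x" using G x unfolding is_support_def by blast
    obtain g' where g': "g' \<in> H" "re_inner x g' = k x" using H x unfolding is_support_def by blast
    have "re_inner x (?c g g') = a * h x + b * k x"
      using pairing[OF g(1) g'(1)] g(2) g'(2) by simp
    moreover have "?c g g' \<in> (\<lambda>(g, g'). ?c g g') ` (G \<times> H)" using g g' by auto
    ultimately show "\<exists>u\<in>(\<lambda>(g, g'). ?c g g') ` (G \<times> H). re_inner x u = a * h x + b * k x"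
      by blast
  qed
qed

section \<open>Total variation as a support function\<close>

definition vdiff :: "complex mat \<Rightarrow> nat \<Rightarrow> nat \<Rightarrow> complex" where
  "vdiff X i j = X $$ (i, j) - X $$ (i + 1, j)"

definition hdiff :: "complex mat \<Rightarrow> nat \<Rightarrow> nat \<Rightarrow> complex" where
  "hdiff X i j = X $$ (i, j) - X $$ (i, j + 1)"

text \<open>The common form of the two total variations. The last row and the last column have only one
  difference per pixel, for which both use the modulus.\<close>

definition cell_TV :: "(complex \<times> complex \<Rightarrow> real) \<Rightarrow> complex mat \<Rightarrow> real" where
  "cell_TV \<nu> X = (let I = dim_row X; J = dim_col X in
     (\<Sum>i<I - 1. \<Sum>j<J - 1. \<nu> (vdiff X i j, hdiff X i j))
   + (\<Sum>i<I - 1. cmod (vdiff X i (J - 1)))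
   + (\<Sum>j<J - 1. cmod (hdiff X (I - 1) j)))"

definition cell_dual ::
  "(complex \<times> complex) set \<Rightarrow> nat \<Rightarrow> nat \<Rightarrow> (complex mat \<times> complex mat) set" where
  "cell_dual U I J = {(P, Q). P \<in> carrier_mat (I - 1) J \<and> Q \<in> carrier_mat I (J - 1) \<and>
     (\<forall>i<I - 1. \<forall>j<J - 1. (P $$ (i, j), Q $$ (i, j)) \<in> U) \<and>
     (\<forall>i<I - 1. cmod (P $$ (i, J - 1)) \<le> 1) \<and>
     (\<forall>j<J - 1. cmod (Q $$ (I - 1, j)) \<le> 1)}"

lemma TV_iso_eq_cell_TV: "TV_iso = cell_TV norm"
  by (rule ext) (simp add: TV_iso_def cell_TV_def vdiff_def hdiff_def norm_Pair)

lemma P1_set_eq_cell_dual: "P1_set I J = cell_dual {u. norm u \<le> 1} I J"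
  by (simp add: P1_set_def cell_dual_def norm_Pair)

lemma TV_l1_eq_cell_TV: "TV_l1 = cell_TV (\<lambda>(a, b). cmod a + cmod b)"
  by (rule ext) (simp add: TV_l1_def cell_TV_def vdiff_def hdiff_def)

text \<open>The bounds in \<open>P2_set\<close> run over all columns of \<open>P\<close> and all rows of \<open>Q\<close>; splitting off the last
  column of \<open>P\<close> and the last row of \<open>Q\<close> separates the interior cells from the boundary.\<close>

lemma P2_set_eq_cell_dual:
  assumes "I \<ge> 1" "J \<ge> 1"
  shows "P2_set I J = cell_dual {(p, q). cmod p \<le> 1 \<and> cmod q \<le> 1} I J"
proof -
  have split: "(\<forall>k<n. R k) \<longleftrightarrow> (\<forall>k<n - 1. R k) \<and> R (n - 1)" if "n \<ge> 1" for n :: nat and R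
    using that by (cases n) (auto simp: less_Suc_eq)
  show ?thesis
    unfolding P2_set_def cell_dual_def split[OF assms(1), where R = "\<lambda>i. \<forall>j<J - 1. _ i j"]
      split[OF assms(2)]
    by auto
qed

text \<open>Extending \<open>p\<close> by zero on both sides removes the boundary terms. The guards are those of
  \<open>L_op\<close>.\<close>

lemma sum_by_parts:
  fixes a p :: "nat \<Rightarrow> 'a :: real_inner"
  shows "(\<Sum>i<Suc m. inner (a i) ((if i < m then p i else 0) - (if 0 < i then p (i - 1) else 0)))
    = (\<Sum>i<m. inner (a i - a (Suc i)) (p i))"
proof -
  have "(\<Sum>i<Suc m. inner (a i) (if i < m then p i else 0)) = (\<Sum>i<m. inner (a i) (p i))"
    by simp
  moreover have "(\<Sum>i<Suc m. inner (a i) (if 0 < i then p (i - 1) else 0))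
      = (\<Sum>i<m. inner (a (Suc i)) (p i))"
    by (subst sum.lessThan_Suc_shift) simp
  ultimately show ?thesis
    by (simp only: inner_diff_right inner_diff_left sum_subtractf)
qed

lemma re_inner_vec_stack:
  assumes "Y \<in> carrier_mat I J"
  shows "re_inner x (vec_stack Y) = (\<Sum>j<J. \<Sum>i<I. inner (mat_unstack I J x $$ (i, j)) (Y $$ (i, j)))"
proof -
  have Y: "dim_row Y = I" "dim_col Y = J" using assms by auto
  have "re_inner x (vec_stack Y) = (\<Sum>k<J * I. inner (x $ k) (vec_stack Y $ k))"
    using Y by (simp add: re_inner_eq_sum[of _ "J * I"] vec_stack_def carrier_vecI mult.commute)
  also have "\<dots> = (\<Sum>j<J. \<Sum>k=j * I..<j * I + I. inner (x $ k) (vec_stack Y $ k))"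
    by (rule sum.nat_group[symmetric])
  also have "\<dots> = (\<Sum>j<J. \<Sum>i<I. inner (x $ (j * I + i)) (vec_stack Y $ (j * I + i)))"
    by (rule sum.cong[OF refl], subst sum.atLeastLessThan_shift_0) (simp add: lessThan_atLeast0)
  also have "\<dots> = (\<Sum>j<J. \<Sum>i<I. inner (mat_unstack I J x $$ (i, j)) (Y $$ (i, j)))"
  proof (intro sum.cong refl)
    fix j i assume "j \<in> {..<J}" "i \<in> {..<I}"
    then have ij: "i < I" "j < J" by auto
    have "j * I + i < Suc j * I" using ij by simp
    also have "\<dots> \<le> J * I" using ij by (intro mult_le_mono1) simp
    finally have "j * I + i < I * J" by (simp add: mult.commute)
    then show "inner (x $ (j * I + i)) (vec_stack Y $ (j * I + i))
        = inner (mat_unstack I J x $$ (i, j)) (Y $$ (i, j))"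
      using ij Y by (simp add: vec_stack_def mat_unstack_def)
  qed
  finally show ?thesis .
qed

text \<open>\<open>L_op\<close> is the adjoint of the discrete gradient: summation by parts in each column for \<open>P\<close> and
  in each row for \<open>Q\<close>. The result is grouped into interior cells, last column and last row, so
  that it matches \<open>cell_TV\<close> term by term.\<close>

lemma re_inner_L_op:
  fixes x :: "complex vec"
  assumes "I \<ge> 1" "J \<ge> 1"
  defines "X \<equiv> mat_unstack I J x"
  shows "re_inner x (vec_stack (L_op I J P Q))
    = (\<Sum>i<I - 1. \<Sum>j<J - 1. inner (vdiff X i j, hdiff X i j) (P $$ (i, j), Q $$ (i, j)))
    + (\<Sum>i<I - 1. inner (vdiff X i (J - 1)) (P $$ (i, J - 1)))
    + (\<Sum>j<J - 1. inner (hdiff X (I - 1) j) (Q $$ (I - 1, j)))"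
proof -
  obtain m n where I: "I = Suc m" and J: "J = Suc n"
    using assms(1,2) by (metis Suc_le_D One_nat_def)
  let ?p = "\<lambda>i j. inner (X $$ (i, j)) ((if i < m then P $$ (i, j) else 0) - (if 0 < i then P $$ (i - 1, j) else 0))"
  let ?q = "\<lambda>i j. inner (X $$ (i, j)) ((if j < n then Q $$ (i, j) else 0) - (if 0 < j then Q $$ (i, j - 1) else 0))"
  have L: "L_op I J P Q \<in> carrier_mat I J" by (simp add: L_op_def)
  have "re_inner x (vec_stack (L_op I J P Q)) = (\<Sum>j<J. \<Sum>i<I. ?p i j + ?q i j)"
    unfolding re_inner_vec_stack[OF L] X_def[symmetric]
    by (intro sum.cong refl) (simp add: L_op_def I J inner_add_right inner_diff_right)
  also have "\<dots> = (\<Sum>j<Suc n. \<Sum>i<Suc m. ?p i j) + (\<Sum>i<Suc m. \<Sum>j<Suc n. ?q i j)"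
    unfolding sum.distrib I J by (simp only: sum.swap[of ?q])
  also have "(\<Sum>j<Suc n. \<Sum>i<Suc m. ?p i j) = (\<Sum>j<Suc n. \<Sum>i<m. inner (vdiff X i j) (P $$ (i, j)))"
    by (rule sum.cong[OF refl], subst sum_by_parts) (simp add: vdiff_def)
  also have "(\<Sum>i<Suc m. \<Sum>j<Suc n. ?q i j) = (\<Sum>i<Suc m. \<Sum>j<n. inner (hdiff X i j) (Q $$ (i, j)))"
    by (rule sum.cong[OF refl], subst sum_by_parts) (simp add: hdiff_def)
  also have "(\<Sum>j<Suc n. \<Sum>i<m. inner (vdiff X i j) (P $$ (i, j)))
      = (\<Sum>i<m. \<Sum>j<n. inner (vdiff X i j) (P $$ (i, j))) + (\<Sum>i<m. inner (vdiff X i n) (P $$ (i, n)))"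
    unfolding sum.swap[of _ "{..<m}"] by (simp add: sum.distrib)
  finally show ?thesis by (simp add: I J inner_Pair sum.distrib)
qed

lemma cell_dual_convex:
  assumes IJ: "I \<ge> 1" "J \<ge> 1" and U: "convex U" and PQ: "(P, Q) \<in> cell_dual U I J" and PQ': "(P', Q') \<in> cell_dual U I J"
    and t: "t \<in> {0..1}"
  defines "c \<equiv> \<lambda>a b. complex_of_real (1 - t) * a + complex_of_real t * b"
  shows "(mat (I - 1) J (\<lambda>k. c (P $$ k) (P' $$ k)), mat I (J - 1) (\<lambda>k. c (Q $$ k) (Q' $$ k)))
    \<in> cell_dual U I J"
proof -
  have unit: "cmod (c a b) \<le> 1" if "cmod a \<le> 1" "cmod b \<le> 1" for a b
    unfolding c_def using norm_mix_le_1[OF that t] .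
  have pair: "(c p p', c q q') \<in> U" if "(p, q) \<in> U" "(p', q') \<in> U" for p q p' q'
    using convexD[OF U that, of "1 - t" t] t by (simp add: c_def scaleR_conv_of_real)
  show ?thesis
    using PQ PQ' IJ by (auto simp: cell_dual_def intro!: unit pair)
qed

lemma vec_stack_L_op_mix:
  fixes t :: real
  assumes "I \<ge> 1" "J \<ge> 1"
  defines "c \<equiv> \<lambda>a b. complex_of_real (1 - t) * a + complex_of_real t * b"
  shows "mix t (vec_stack (L_op I J P Q)) (vec_stack (L_op I J P' Q'))
    = vec_stack (L_op I J (mat (I - 1) J (\<lambda>k. c (P $$ k) (P' $$ k)))
        (mat I (J - 1) (\<lambda>k. c (Q $$ k) (Q' $$ k))))"
proof (rule eq_vecI)
  fix k assume "k < dim_vec (vec_stack (L_op I J (mat (I - 1) J (\<lambda>k. c (P $$ k) (P' $$ k)))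
        (mat I (J - 1) (\<lambda>k. c (Q $$ k) (Q' $$ k)))))"
  then have k: "k < I * J" by (simp add: vec_stack_def L_op_def)
  then have "k mod I < I" "k div I < J"
    using assms(1) by (auto simp: less_mult_imp_div_less mult.commute)
  with k show "mix t (vec_stack (L_op I J P Q)) (vec_stack (L_op I J P' Q')) $ k
    = vec_stack (L_op I J (mat (I - 1) J (\<lambda>k. c (P $$ k) (P' $$ k)))
        (mat I (J - 1) (\<lambda>k. c (Q $$ k) (Q' $$ k)))) $ k"
    by (simp add: mix_def vec_stack_def L_op_def c_def algebra_simps)
qed (simp add: mix_def vec_stack_def L_op_def)

text \<open>By \<open>re_inner_L_op\<close> the pairing decouples: each interior cell contributes its gradient paired
  with an element of \<open>U\<close>, and each boundary edge its difference paired with an element of the unit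
  disc. These elements can be chosen independently, so the maximum of the sum is the sum of the
  maxima. The hypotheses say that \<open>\<nu>\<close> is the attained support function of \<open>U\<close>.\<close>

lemma is_support_cell_TV:
  assumes IJ: "I \<ge> 1" "J \<ge> 1" and U: "convex U"
    and bound: "\<And>a u. u \<in> U \<Longrightarrow> inner a u \<le> \<nu> a"
    and attained: "\<And>a. \<exists>u\<in>U. inner a u = \<nu> a"
  shows "is_support (I * J) ((\<lambda>(P, Q). vec_stack (L_op I J P Q)) ` cell_dual U I J)
    (\<lambda>x. cell_TV \<nu> (mat_unstack I J x))"
  unfolding is_support_def
proof (intro conjI ballI)
  show "(\<lambda>(P, Q). vec_stack (L_op I J P Q)) ` cell_dual U I J \<subseteq> carrier_vec (I * J)"
    by (auto simp: vec_stack_def L_op_def carrier_vecI)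
next
  fix g g' t
  assume "g \<in> (\<lambda>(P, Q). vec_stack (L_op I J P Q)) ` cell_dual U I J"
    and "g' \<in> (\<lambda>(P, Q). vec_stack (L_op I J P Q)) ` cell_dual U I J"
    and t: "t \<in> {0..(1::real)}"
  then obtain P Q P' Q' where PQ: "(P, Q) \<in> cell_dual U I J" "(P', Q') \<in> cell_dual U I J"
    and g: "g = vec_stack (L_op I J P Q)" "g' = vec_stack (L_op I J P' Q')" by auto
  show "mix t g g' \<in> (\<lambda>(P, Q). vec_stack (L_op I J P Q)) ` cell_dual U I J"
    unfolding g vec_stack_L_op_mix[OF IJ] using cell_dual_convex[OF IJ U PQ t] by force
next
  fix x g assume "g \<in> (\<lambda>(P, Q). vec_stack (L_op I J P Q)) ` cell_dual U I J"
  then obtain P Q where PQ: "(P, Q) \<in> cell_dual U I J" and g: "g = vec_stack (L_op I J P Q)" by auto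
  have dim: "dim_row (mat_unstack I J x) = I" "dim_col (mat_unstack I J x) = J"
    by (simp_all add: mat_unstack_def)
  show "re_inner x g \<le> cell_TV \<nu> (mat_unstack I J x)"
    unfolding g re_inner_L_op[OF IJ] cell_TV_def dim Let_def
    using PQ by (intro add_mono sum_mono bound inner_le_norm) (auto simp: cell_dual_def)
next
  fix x :: "complex vec"
  define X where "X = mat_unstack I J x"
  have dim: "dim_row X = I" "dim_col X = J" by (simp_all add: X_def mat_unstack_def)
  obtain u where u: "\<And>a. u a \<in> U" "\<And>a. inner a (u a) = \<nu> a" using attained by metis
  let ?u = "\<lambda>i j. u (vdiff X i j, hdiff X i j)"
  define P where "P = mat (I - 1) J
    (\<lambda>(i, j). if j < J - 1 then fst (?u i j) else sgn (vdiff X i j))"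
  define Q where "Q = mat I (J - 1)
    (\<lambda>(i, j). if i < I - 1 then snd (?u i j) else sgn (hdiff X i j))"
  have "(P, Q) \<in> cell_dual U I J"
    using IJ by (auto simp: cell_dual_def P_def Q_def u(1) norm_sgn)
  moreover have "re_inner x (vec_stack (L_op I J P Q)) = cell_TV \<nu> X"
    unfolding re_inner_L_op[OF IJ] cell_TV_def dim Let_def X_def[symmetric]
    using IJ by (intro arg_cong2[where f = "(+)"] sum.cong refl)
      (auto simp: P_def Q_def inner_sgn_right u(2))
  ultimately show "\<exists>g\<in>(\<lambda>(P, Q). vec_stack (L_op I J P Q)) ` cell_dual U I J.
      re_inner x g = cell_TV \<nu> (mat_unstack I J x)"
    unfolding X_def by force
qed

text \<open>The Euclidean norm on pairs is self-dual.\<close>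

lemma is_support_TV_iso:
  assumes "I \<ge> 1" "J \<ge> 1"
  shows "is_support (I * J) ((\<lambda>(P, Q). vec_stack (L_op I J P Q)) ` P1_set I J)
    (\<lambda>x. TV_iso (mat_unstack I J x))"
  unfolding TV_iso_eq_cell_TV P1_set_eq_cell_dual
proof (rule is_support_cell_TV[OF assms])
  show "convex {u :: complex \<times> complex. norm u \<le> 1}"
    by (rule convexI) (auto intro: norm_convex_combination_le_1)
  show "\<exists>u\<in>{u. norm u \<le> 1}. inner a u = norm a" for a :: "complex \<times> complex"
    by (rule bexI[of _ "sgn a"]) (auto simp: inner_sgn_right norm_sgn)
qed (simp add: inner_le_norm)

text \<open>The dual of the \<open>\<ell>\<^sub>1\<close> norm on pairs is the maximum norm.\<close>

lemma is_support_TV_l1: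
  assumes "I \<ge> 1" "J \<ge> 1"
  shows "is_support (I * J) ((\<lambda>(P, Q). vec_stack (L_op I J P Q)) ` P2_set I J)
    (\<lambda>x. TV_l1 (mat_unstack I J x))"
  unfolding TV_l1_eq_cell_TV P2_set_eq_cell_dual[OF assms]
proof (rule is_support_cell_TV[OF assms])
  show "convex {(p, q). cmod p \<le> 1 \<and> cmod q \<le> 1}"
    by (rule convexI) (auto intro: norm_convex_combination_le_1)
  show "inner a u \<le> (case a of (a, b) \<Rightarrow> cmod a + cmod b)"
    if "u \<in> {(p, q). cmod p \<le> 1 \<and> cmod q \<le> 1}" for a u
    using that by (cases a) (auto intro!: add_mono inner_le_norm)
  show "\<exists>u\<in>{(p, q). cmod p \<le> 1 \<and> cmod q \<le> 1}. inner a u = (case a of (a, b) \<Rightarrow> cmod a + cmod b)"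
    for a
    by (rule bexI[of _ "(sgn (fst a), sgn (snd a))"])
      (auto simp: inner_sgn_right norm_sgn split: prod.split)
qed

section \<open>The dual characterisation of the regularised minimiser\<close>

theorem proposition1:
  fixes I J N Nt :: nat
    and T B :: "complex mat"
    and v zs :: "complex vec"
    and Ps Qs :: "complex mat"
    and lam \<alpha> :: real
    and TV :: "complex mat \<Rightarrow> real"
    and PP :: "(complex mat \<times> complex mat) set"
  assumes "I \<ge> 1" and "J \<ge> 1" and "Nt \<ge> 1" and "N = I * J"
    and "T \<in> carrier_mat Nt N"
    and "hermitian_pos_def N B"
    and "v \<in> carrier_vec N"
    and "lam > 0" and "0 \<le> \<alpha>" and "\<alpha> \<le> 1"
    and "(TV, PP) = (TV_iso, P1_set I J) \<or> (TV, PP) = (TV_l1, P2_set I J)"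
    and "is_arg_min
           (\<lambda>(z, P, Q). (weighted_norm B (w_map I J T B v lam \<alpha> z P Q))\<^sup>2)
           (\<lambda>(z, P, Q). z \<in> Z_set Nt \<and> (P, Q) \<in> PP)
           (zs, Ps, Qs)"
  shows "{x. is_arg_min
               (\<lambda>x. (weighted_norm B (x - v))\<^sup>2
                    + 2 * lam * (\<alpha> * l1_norm (T *\<^sub>v x) + (1 - \<alpha>) * TV (mat_unstack I J x)))
               (\<lambda>x. x \<in> carrier_vec N) x}
         = {w_map I J T B v lam \<alpha> zs Ps Qs}"
proof -
  have TV: "is_support N ((\<lambda>(P, Q). vec_stack (L_op I J P Q)) ` PP) (\<lambda>x. TV (mat_unstack I J x))"
    using assms(11) is_support_TV_iso[OF assms(1,2)] is_support_TV_l1[OF assms(1,2)] assms(4) by auto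
  define G where "G = (\<lambda>(g, g'). complex_of_real \<alpha> \<cdot>\<^sub>v g + complex_of_real (1 - \<alpha>) \<cdot>\<^sub>v g') `
    ((\<lambda>z. mat_adjoint T *\<^sub>v z) ` Z_set Nt \<times> (\<lambda>(P, Q). vec_stack (L_op I J P Q)) ` PP)"
  have G: "is_support N G (\<lambda>x. \<alpha> * l1_norm (T *\<^sub>v x) + (1 - \<alpha>) * TV (mat_unstack I J x))"
    unfolding G_def using assms(9,10)
    by (intro is_support_nonneg_combination is_support_mat_adjoint[OF assms(5) is_support_l1_norm] TV) auto
  define dual where "dual = (\<lambda>z P Q. complex_of_real \<alpha> \<cdot>\<^sub>v (mat_adjoint T *\<^sub>v z)
        + complex_of_real (1 - \<alpha>) \<cdot>\<^sub>v vec_stack (L_op I J P Q))"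
  define w where "w = (\<lambda>g. v - complex_of_real lam \<cdot>\<^sub>v (the (mat_inverse B) *\<^sub>v g))"
  have w_map: "w_map I J T B v lam \<alpha> z P Q = w (dual z P Q)" for z P Q
    by (simp add: w_map_def w_def dual_def)
  have dual_G: "g \<in> G \<longleftrightarrow> (\<exists>z P Q. z \<in> Z_set Nt \<and> (P, Q) \<in> PP \<and> g = dual z P Q)" for g
    unfolding G_def dual_def by force
  have star: "zs \<in> Z_set Nt" "(Ps, Qs) \<in> PP"
    and least: "\<And>z P Q. z \<in> Z_set Nt \<Longrightarrow> (P, Q) \<in> PP \<Longrightarrow>
      (weighted_norm B (w (dual zs Ps Qs)))\<^sup>2 \<le> (weighted_norm B (w (dual z P Q)))\<^sup>2"
    using assms(12) by (auto simp: is_arg_min_def w_map not_less)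
  show ?thesis
    unfolding w_map
  proof (rule dual_minimiser_gives_primal_minimiser[where w = w and gs = "dual zs Ps Qs", OF assms(6-8) G])
    show "dual zs Ps Qs \<in> G" using star dual_G by blast
    show "(weighted_norm B (w (dual zs Ps Qs)))\<^sup>2 \<le> (weighted_norm B (w g))\<^sup>2" if "g \<in> G" for g
      using that least dual_G by auto
  qed (simp add: w_def)
qed

end
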